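(* Let $X$ be a real Banach space with $\dim X\geqslant 2$. Then $t\mapsto L_X(t)$ is non-increasing on $[0,\frac12)$.
   Context: For $x,y$ in a real Banach space $X$, isosceles orthogonality $x\perp_I y$ means $\|x+y\|=\|x-y\|$. For $0\leqslant t<\frac12$ define $$L_X(t)=\sup\left\{\frac{\|tx+(1-t)y\|^2+\|(1-t)x+ty\|^2}{\|x+y\|^2}: x,y\in X,\ (x,y)\neq(0,0),\ x\perp_I y\right\}.$$ *)

theory Defs
  imports "HOL-Analysis.Analysis"
begin

definition isosceles_orthogonal :: "'a::real_normed_vector \<Rightarrow> 'a \<Rightarrow> bool"
    (infix "\<bottom>\<^sub>I" 50)
  where "x \<bottom>\<^sub>I y \<longleftrightarrow> norm (x + y) = norm (x - y)"

text \<open>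
  The space \<open>X\<close> is the whole type, passed as a type token. On the domain of \<open>L_const\<close>,
  namely \<open>0 \<le> t < 1/2\<close>, the quotients are honest (if \<open>x \<bottom>\<^sub>I y\<close> and \<open>x + y = 0\<close> then
  \<open>x = y = 0\<close>) and the supremum is a genuine one in the reals; see the lemmas below.
\<close>

definition L_quotients :: "'a::real_normed_vector itself \<Rightarrow> real \<Rightarrow> real set"
  where "L_quotients X t =
    {((norm (t *\<^sub>R x + (1 - t) *\<^sub>R y))\<^sup>2 + (norm ((1 - t) *\<^sub>R x + t *\<^sub>R y))\<^sup>2) / (norm (x + y))\<^sup>2
      | x y :: 'a. (x, y) \<noteq> (0, 0) \<and> x \<bottom>\<^sub>I y}"

definition L_const :: "'a::real_normed_vector itself \<Rightarrow> real \<Rightarrow> real"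
  where "L_const X t = Sup (L_quotients X t)"

lemma isosceles_orthogonal_add_nonzero:
  fixes x y :: "'a::real_normed_vector"
  assumes "x \<bottom>\<^sub>I y" "(x, y) \<noteq> (0, 0)"
  shows "x + y \<noteq> 0"
proof
  assume s: "x + y = 0"
  with assms(1) have "x - y = 0"
    by (simp add: isosceles_orthogonal_def)
  then have "x = y" by simp
  with s have "2 *\<^sub>R x = 0" by (simp add: scaleR_2)
  then show False using \<open>x = y\<close> assms(2) by simp
qed

lemma L_quotients_nonempty:
  assumes "\<exists>x::'a::real_normed_vector. x \<noteq> 0"
  shows "L_quotients TYPE('a) t \<noteq> {}"
proof -
  obtain x :: 'a where "x \<noteq> 0" using assms by blast
  then have "(x, 0::'a) \<noteq> (0, 0) \<and> x \<bottom>\<^sub>I 0"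
    by (simp add: isosceles_orthogonal_def)
  then show ?thesis unfolding L_quotients_def by blast
qed

lemma L_quotients_bdd_above:
  assumes "0 \<le> t" "t < 1/2"
  shows "bdd_above (L_quotients TYPE('a::real_normed_vector) t)"
proof (rule bdd_aboveI)
  fix q assume "q \<in> L_quotients TYPE('a) t"
  then obtain x y :: 'a where xy: "(x, y) \<noteq> (0, 0)" "x \<bottom>\<^sub>I y" and
    q: "q = ((norm (t *\<^sub>R x + (1 - t) *\<^sub>R y))\<^sup>2 + (norm ((1 - t) *\<^sub>R x + t *\<^sub>R y))\<^sup>2) / (norm (x + y))\<^sup>2"
    unfolding L_quotients_def by blast
  have pos: "norm (x + y) > 0"
    using isosceles_orthogonal_add_nonzero[OF xy(2,1)] by simp
  have eq: "norm (x - y) = norm (x + y)" "norm (y - x) = norm (x + y)"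
    using xy(2) by (simp_all add: isosceles_orthogonal_def norm_minus_commute)
  have bound: "norm ((1/2) *\<^sub>R (x + y) + (1/2 - t) *\<^sub>R z) \<le> norm (x + y)"
    if "norm z = norm (x + y)" for z :: 'a
  proof -
    have "norm ((1/2) *\<^sub>R (x + y) + (1/2 - t) *\<^sub>R z)
        \<le> (1/2) * norm (x + y) + (1/2 - t) * norm (x + y)"
      using norm_triangle_ineq[of "(1/2) *\<^sub>R (x + y)" "(1/2 - t) *\<^sub>R z"] that assms
      by simp
    also have "\<dots> = (1 - t) * norm (x + y)" by (simp add: algebra_simps)
    also have "\<dots> \<le> norm (x + y)" using assms by (simp add: mult_left_le_one_le)
    finally show ?thesis .
  qed
  have half: "z = (1/2) *\<^sub>R z + (1/2) *\<^sub>R z" for z :: 'a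
    by (simp flip: scaleR_left_distrib)
  have "t *\<^sub>R x + (1 - t) *\<^sub>R y = (1/2) *\<^sub>R (x + y) + (1/2 - t) *\<^sub>R (y - x)"
    using half[of y] by (simp add: algebra_simps)
  moreover have "(1 - t) *\<^sub>R x + t *\<^sub>R y = (1/2) *\<^sub>R (x + y) + (1/2 - t) *\<^sub>R (x - y)"
    using half[of x] by (simp add: algebra_simps)
  ultimately have "norm (t *\<^sub>R x + (1 - t) *\<^sub>R y) \<le> norm (x + y)"
    "norm ((1 - t) *\<^sub>R x + t *\<^sub>R y) \<le> norm (x + y)"
    using bound[OF eq(1)] bound[OF eq(2)] by simp_all
  then have "(norm (t *\<^sub>R x + (1 - t) *\<^sub>R y))\<^sup>2 + (norm ((1 - t) *\<^sub>R x + t *\<^sub>R y))\<^sup>2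
      \<le> 2 * (norm (x + y))\<^sup>2"
    by (smt (verit) norm_ge_zero power_mono)
  then show "q \<le> 2" unfolding q using pos by (simp add: divide_le_eq)
qed

end

theory Submission imports Defs
begin

text \<open>
  For \<open>s \<le> t < 1/2\<close> the two vectors in the numerator at \<open>t\<close> are the convex combinations, with
  weights \<open>a\<close>, \<open>1 - a\<close> and \<open>1 - a\<close>, \<open>a\<close>, of the two vectors in the numerator at \<open>s\<close>. Convexity
  of the squared norm therefore makes every single quotient non-increasing in \<open>t\<close>, and hence
  also the supremum.
\<close>

text \<open>After the triangle inequality only real numbers remain: the two sides then differ by the
  variance term \<open>a * (1 - a) * (norm x - norm y)\<^sup>2\<close>.\<close>

lemma norm_sq_convex_combination_le:
  fixes x y :: "'a::real_normed_vector"
  assumes "0 \<le> a" "a \<le> 1"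
  shows "(norm (a *\<^sub>R x + (1 - a) *\<^sub>R y))\<^sup>2 \<le> a * (norm x)\<^sup>2 + (1 - a) * (norm y)\<^sup>2"
proof -
  have "norm (a *\<^sub>R x + (1 - a) *\<^sub>R y) \<le> a * norm x + (1 - a) * norm y"
    using norm_triangle_ineq[of "a *\<^sub>R x" "(1 - a) *\<^sub>R y"] assms by simp
  then have "(norm (a *\<^sub>R x + (1 - a) *\<^sub>R y))\<^sup>2 \<le> (a * norm x + (1 - a) * norm y)\<^sup>2"
    by (simp add: power_mono)
  also have "\<dots> = a * (norm x)\<^sup>2 + (1 - a) * (norm y)\<^sup>2 - a * (1 - a) * (norm x - norm y)\<^sup>2"
    by (simp add: power2_eq_square algebra_simps)
  also have "\<dots> \<le> a * (norm x)\<^sup>2 + (1 - a) * (norm y)\<^sup>2"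
    using assms by simp
  finally show ?thesis .
qed

lemma norm_sq_sum_antimono:
  fixes x y :: "'a::real_normed_vector"
  assumes "s \<le> t" "t < 1/2"
  shows "(norm (t *\<^sub>R x + (1 - t) *\<^sub>R y))\<^sup>2 + (norm ((1 - t) *\<^sub>R x + t *\<^sub>R y))\<^sup>2
    \<le> (norm (s *\<^sub>R x + (1 - s) *\<^sub>R y))\<^sup>2 + (norm ((1 - s) *\<^sub>R x + s *\<^sub>R y))\<^sup>2"
proof -
  define u where "u = s *\<^sub>R x + (1 - s) *\<^sub>R y"
  define v where "v = (1 - s) *\<^sub>R x + s *\<^sub>R y"
  \<comment> \<open>The solution of \<open>a * s + (1 - a) * (1 - s) = t\<close>. Here
    \<open>0 \<le> a\<close> amounts to \<open>s + t \<le> 1\<close>, and \<open>a \<le> 1\<close>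
    to \<open>s \<le> t\<close>.\<close>
  define a where "a = (1 - s - t) / (1 - 2 * s)"
  have a: "0 \<le> a" "a \<le> 1" and "a * (1 - 2 * s) = 1 - s - t"
    using assms by (simp_all add: a_def)
  then have t: "a * s + (1 - a) * (1 - s) = t"
    by (simp add: algebra_simps)
  have t': "a * (1 - s) + (1 - a) * s = 1 - t"
    using t by (simp add: algebra_simps)
  have u: "t *\<^sub>R x + (1 - t) *\<^sub>R y = a *\<^sub>R u + (1 - a) *\<^sub>R v"
    \<comment> \<open>\<open>1 - t\<close> is replaced first, since expanding \<open>t\<close> would
      destroy that pattern.\<close>
    unfolding u_def v_def t'[symmetric] unfolding t[symmetric]
    by (simp only: scaleR_add_left scaleR_add_right scaleR_scaleR ac_simps)
  have v: "(1 - t) *\<^sub>R x + t *\<^sub>R y = a *\<^sub>R v + (1 - a) *\<^sub>R u"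
    unfolding u_def v_def t'[symmetric] unfolding t[symmetric]
    by (simp only: scaleR_add_left scaleR_add_right scaleR_scaleR ac_simps)
  \<comment> \<open>With the weights swapped, each squared norm gets total weight
    \<open>a + (1 - a) = 1\<close>.\<close>
  have "(norm (a *\<^sub>R u + (1 - a) *\<^sub>R v))\<^sup>2 + (norm (a *\<^sub>R v + (1 - a) *\<^sub>R u))\<^sup>2
      \<le> (norm u)\<^sup>2 + (norm v)\<^sup>2"
    using norm_sq_convex_combination_le[OF a, of u v] norm_sq_convex_combination_le[OF a, of v u]
    by (simp add: algebra_simps)
  then show ?thesis
    unfolding u v u_def[symmetric] v_def[symmetric] .
qed

theorem mainTheorem5:
  assumes dim_ge_2: "\<exists>B :: 'a::banach set. independent B \<and> card B = 2"
  shows "antimono_on {0..<1/2} (L_const TYPE('a))"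
proof (rule monotone_onI)
  fix s t :: real
  assume "s \<in> {0..<1/2}" "t \<in> {0..<1/2}" "s \<le> t"
  then have st: "0 \<le> s" "s < 1/2" "s \<le> t" "t < 1/2" by auto
  obtain B :: "'a set" where "independent B" "card B = 2"
    using dim_ge_2 by blast
  \<comment> \<open>Of two distinct vectors one is nonzero; this makes the set of quotients at
    \<open>t\<close> nonempty, as \<open>cSup_mono\<close> requires.\<close>
  then have "\<exists>x::'a. x \<noteq> 0"
    by (metis card_2_iff insertCI)
  then show "L_const TYPE('a) t \<le> L_const TYPE('a) s"
    unfolding L_const_def
  proof (intro cSup_mono L_quotients_nonempty L_quotients_bdd_above st)
    fix q assume "q \<in> L_quotients TYPE('a) t"
    then obtain x y :: 'a where xy: "(x, y) \<noteq> (0, 0)" "x \<bottom>\<^sub>I y"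
      and q: "q = ((norm (t *\<^sub>R x + (1 - t) *\<^sub>R y))\<^sup>2 + (norm ((1 - t) *\<^sub>R x + t *\<^sub>R y))\<^sup>2)
        / (norm (x + y))\<^sup>2"
      unfolding L_quotients_def by blast
    \<comment> \<open>The same pair serves at \<open>s\<close>: neither orthogonality nor the
      denominator depends on the parameter.\<close>
    have "q \<le> ((norm (s *\<^sub>R x + (1 - s) *\<^sub>R y))\<^sup>2 + (norm ((1 - s) *\<^sub>R x + s *\<^sub>R y))\<^sup>2)
        / (norm (x + y))\<^sup>2"
      unfolding q by (intro divide_right_mono norm_sq_sum_antimono st) simp
    then show "\<exists>r\<in>L_quotients TYPE('a) s. q \<le> r"
      unfolding L_quotients_def using xy by blast
  qed
qed

end
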